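(* For each $\alpha\in[1,\infty]$ and each $p\in(0,1)$, the quantile bound $Q_\alpha(\cdot;p)$ is a coherent risk measure (on $\mathcal X_\alpha$).
   Context: For real $u$, $u_+:=\max(0,u)$ and $u_+^\alpha:=(u_+)^\alpha$. Define $h_\alpha(u)=(1+u/\alpha)_+^\alpha$ for $0<\alpha<\infty$ and $h_\infty(u)=e^u$, $u\in\mathbb R$. For a random variable $X$, $x\in\mathbb R$, $p\in(0,1)$ put $$P_\alpha(X;x):=\inf_{\lambda\in(0,\infty)}\mathsf E\,h_\alpha(\lambda(X-x)),\qquad Q_\alpha(X;p):=\inf\{x\in\mathbb R:P_\alpha(X;x)<p\}.$$ For $\alpha\in[1,\infty)$, $\mathcal X_\alpha$ is the set of real-valued random variables $X$ on a given probability space with $\mathsf E X_+^\alpha<\infty$; $\mathcal X_\infty$ is the set of those with $\mathsf E e^{\lambda X}<\infty$ for some real $\lambda>0$. ($\mathcal X_\alpha$ is a convex cone containing the real constants.) A risk measure $\rho$ (a functional of the random loss $X$) is coherent if it has the following properties: translation invariance, $\rho(X+c)=\rho(X)+c$ for all $c\in\mathbb R$; subadditivity, $\rho(X+Y)\le\rho(X)+\rho(Y)$; positive homogeneity, $\rho(\lambda X)=\lambda\rho(X)$ for all real $\lambda\ge0$; and monotonicity, $\rho(X)\le\rho(Y)$ whenever $X\le Y$. *)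

theory Defs
  imports "HOL-Probability.Probability"
begin

text \<open>The order \<open>\<alpha>\<close> ranges over the extended reals, so that \<open>\<alpha> = \<infinity>\<close> is allowed;
  only \<open>\<alpha> > 0\<close> is meaningful. Note that \<open>0 powr a = 0\<close> for every real \<open>a\<close>.\<close>

definition h_fun :: "ereal \<Rightarrow> real \<Rightarrow> real" where
  "h_fun \<alpha> u =
     (if \<alpha> = \<infinity> then exp u
      else max 0 (1 + u / real_of_ereal \<alpha>) powr real_of_ereal \<alpha>)"

text \<open>Expectations of nonnegative variables are taken in \<open>[0, \<infinity>]\<close>: for \<open>X\<close> in the class
  of order \<open>\<infinity>\<close> below, the expectation may be infinite for some of the scalings \<open>t\<close>.\<close>

definition P_bound :: "'a measure \<Rightarrow> ereal \<Rightarrow> ('a \<Rightarrow> real) \<Rightarrow> real \<Rightarrow> ennreal" where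
  "P_bound M \<alpha> X x =
     (INF t\<in>{0<..}. \<integral>\<^sup>+ \<omega>. ennreal (h_fun \<alpha> (t * (X \<omega> - x))) \<partial>M)"

text \<open>The infimum is taken in the extended reals, so no convention about empty or unbounded sets
  is hidden in the definition.\<close>

definition Q_bound :: "'a measure \<Rightarrow> ereal \<Rightarrow> ('a \<Rightarrow> real) \<Rightarrow> real \<Rightarrow> ereal" where
  "Q_bound M \<alpha> X p = (INF x\<in>{x. P_bound M \<alpha> X x < ennreal p}. ereal x)"

definition X_class :: "'a measure \<Rightarrow> ereal \<Rightarrow> ('a \<Rightarrow> real) set" where
  "X_class M \<alpha> =
     (if \<alpha> = \<infinity>
      then {X \<in> borel_measurable M.
              \<exists>t>0. (\<integral>\<^sup>+ \<omega>. ennreal (exp (t * X \<omega>)) \<partial>M) < \<infinity>}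
      else {X \<in> borel_measurable M.
              (\<integral>\<^sup>+ \<omega>. ennreal (max 0 (X \<omega>) powr real_of_ereal \<alpha>) \<partial>M) < \<infinity>})"

text \<open>The first conjunct says that \<open>\<rho>\<close> is a real-valued functional on \<open>C\<close>. When \<open>C\<close> is a convex cone containing the real constants, the
  remaining conjuncts are thus statements about real numbers. Inequalities between random variables
  are understood almost surely; this includes the pointwise ones.\<close>

definition coherent_risk_measure_on ::
    "'a measure \<Rightarrow> ('a \<Rightarrow> real) set \<Rightarrow> (('a \<Rightarrow> real) \<Rightarrow> ereal) \<Rightarrow> bool" where
  "coherent_risk_measure_on M C \<rho> \<longleftrightarrow>
     (\<forall>X\<in>C. \<bar>\<rho> X\<bar> \<noteq> \<infinity>) \<and>
     (\<forall>X\<in>C. \<forall>c::real. \<rho> (\<lambda>\<omega>. X \<omega> + c) = \<rho> X + ereal c) \<and>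
     (\<forall>X\<in>C. \<forall>Y\<in>C. \<rho> (\<lambda>\<omega>. X \<omega> + Y \<omega>) \<le> \<rho> X + \<rho> Y) \<and>
     (\<forall>X\<in>C. \<forall>c\<ge>0::real. \<rho> (\<lambda>\<omega>. c * X \<omega>) = ereal c * \<rho> X) \<and>
     (\<forall>X\<in>C. \<forall>Y\<in>C. (AE \<omega> in M. X \<omega> \<le> Y \<omega>) \<longrightarrow> \<rho> X \<le> \<rho> Y)"

end

theory Submission
  imports Defs
begin

text \<open>All the properties are read off the set of those \<open>x\<close> for which
  \<open>E h(t (X - x)) < p\<close> for some \<open>t > 0\<close>, whose infimum is the quantile bound. Subadditivity rests on
  the convexity of \<open>h\<close>: if \<open>(x, t)\<close> is admissible for \<open>X\<close> and \<open>(y, s)\<close> for \<open>Y\<close>, then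
  \<open>x + y\<close> is admissible for \<open>X + Y\<close> with the parameter \<open>r = t s / (t + s)\<close>, because
  \<open>r (X + Y - x - y)\<close> is the convex combination of \<open>t (X - x)\<close> and \<open>s (Y - y)\<close> with
  weights \<open>r / t\<close> and \<open>r / s\<close>. The bound is finite since \<open>h \<ge> 1\<close> on the nonnegative reals forces
  \<open>P(X \<ge> x) < p\<close> for admissible \<open>x\<close>, which fails for all sufficiently small \<open>x\<close>.\<close>

section \<open>Monotonicity and convexity of \<open>h_fun\<close>\<close>

lemma ge_one_ereal_cases:
  assumes "1 \<le> (\<alpha> :: ereal)"
  obtains "\<alpha> = \<infinity>" | a where "\<alpha> = ereal a" "1 \<le> a"
  using assms by (cases \<alpha>) auto

lemma h_fun_infinity [simp]: "h_fun \<infinity> u = exp u"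
  by (simp add: h_fun_def)

lemma h_fun_ereal [simp]: "h_fun (ereal a) u = max 0 (1 + u / a) powr a"
  by (simp add: h_fun_def)

lemma h_fun_nonneg: "0 \<le> h_fun \<alpha> u"
  by (simp add: h_fun_def)

lemma h_fun_mono:
  assumes "1 \<le> \<alpha>" "u \<le> v"
  shows "h_fun \<alpha> u \<le> h_fun \<alpha> v"
  using assms(1)
proof (cases rule: ge_one_ereal_cases)
  case (2 a)
  have "u / a \<le> v / a"
    using 2 assms(2) by (intro divide_right_mono) auto
  then show ?thesis
    using 2 by (auto intro!: powr_mono2)
qed (use assms in auto)

lemma h_fun_ge_one:
  assumes "1 \<le> \<alpha>" "0 \<le> u"
  shows "1 \<le> h_fun \<alpha> u"
proof -
  have "1 = h_fun \<alpha> 0"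
    using assms(1) by (cases rule: ge_one_ereal_cases) auto
  also have "\<dots> \<le> h_fun \<alpha> u"
    using assms by (rule h_fun_mono)
  finally show ?thesis .
qed

lemma measurable_h_fun [measurable]: "h_fun \<alpha> \<in> borel_measurable borel"
  unfolding h_fun_def by measurable

text \<open>The endpoint 0 has to be included, since the truncated argument inside
  \<open>h_fun\<close> may vanish. If one of the points is 0, the power factors out and the claim
  reduces to \<open>c powr a \<le> c\<close> for a weight \<open>c\<close> in [0,1].\<close>

lemma convex_on_powr_nonneg:
  fixes a :: real
  assumes "1 \<le> a"
  shows "convex_on {0..} (\<lambda>x. x powr a)"
proof (rule convex_onI)
  fix t x y :: real
  assume t: "0 < t" "t < 1" and xy: "x \<in> {0..}" "y \<in> {0..}"
  have le: "c powr a \<le> c" if "0 \<le> c" "c \<le> 1" for c :: real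
    using powr_mono'[of 1 a c] that assms by (cases "c = 0") auto
  show "((1 - t) *\<^sub>R x + t *\<^sub>R y) powr a \<le> (1 - t) * x powr a + t * y powr a"
  proof (cases "x = 0 \<or> y = 0")
    case True
    then show ?thesis
      using t xy le[of t] le[of "1 - t"] by (auto simp: powr_mult intro!: mult_right_mono)
  next
    case False
    then show ?thesis
      using t xy convex_onD[OF powr_convex[OF assms], of t x y] by auto
  qed
qed simp

text \<open>For finite order this is a composition: the positive part of an affine function is
  convex, and the power is convex and increasing on the nonnegative reals.\<close>

lemma convex_on_h_fun:
  assumes "1 \<le> \<alpha>"
  shows "convex_on UNIV (h_fun \<alpha>)"
  using assms
proof (cases rule: ge_one_ereal_cases)
  case 1
  then show ?thesis
    using exp_convex by (simp add: h_fun_def[abs_def])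
next
  case (2 a)
  show ?thesis
  proof (rule convex_onI)
    fix t x y :: real
    assume t: "0 < t" "t < 1"
    let ?m = "\<lambda>u. max 0 (1 + u / a)"
    have "1 + ((1 - t) * x + t * y) / a = (1 - t) * (1 + x / a) + t * (1 + y / a)"
      using 2 by (simp add: field_simps)
    also have "\<dots> \<le> (1 - t) * ?m x + t * ?m y"
      using t by (intro add_mono mult_left_mono) auto
    finally have "?m ((1 - t) * x + t * y) \<le> (1 - t) * ?m x + t * ?m y"
      using t by simp
    then have "?m ((1 - t) * x + t * y) powr a \<le> ((1 - t) * ?m x + t * ?m y) powr a"
      using 2 by (intro powr_mono2) auto
    also have "\<dots> \<le> (1 - t) * ?m x powr a + t * ?m y powr a"
      using convex_onD[OF convex_on_powr_nonneg[OF 2(2)], of t "?m x" "?m y"] t by simp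
    finally show "h_fun \<alpha> ((1 - t) *\<^sub>R x + t *\<^sub>R y) \<le> (1 - t) * h_fun \<alpha> x + t * h_fun \<alpha> y"
      using 2 by simp
  qed simp
qed

section \<open>Admissible thresholds under translation, scaling and addition\<close>

lemma P_bound_less_iff:
  "P_bound M \<alpha> X x < c \<longleftrightarrow>
     (\<exists>t>0. (\<integral>\<^sup>+ \<omega>. ennreal (h_fun \<alpha> (t * (X \<omega> - x))) \<partial>M) < c)"
  unfolding P_bound_def INF_less_iff by auto

lemma P_bound_mono:
  assumes "1 \<le> \<alpha>" "AE \<omega> in M. X \<omega> - x \<le> Y \<omega> - y"
  shows "P_bound M \<alpha> X x \<le> P_bound M \<alpha> Y y"
  unfolding P_bound_def
proof (intro INF_mono bexI nn_integral_mono_AE)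
  fix t :: real
  assume "t \<in> {0<..}"
  then show "AE \<omega> in M. ennreal (h_fun \<alpha> (t * (X \<omega> - x))) \<le> ennreal (h_fun \<alpha> (t * (Y \<omega> - y)))"
    using assms(2) by (auto elim!: eventually_mono intro!: ennreal_leI h_fun_mono assms(1))
qed

lemma P_bound_translate: "P_bound M \<alpha> (\<lambda>\<omega>. X \<omega> + c) (x + c) = P_bound M \<alpha> X x"
  by (simp add: P_bound_def)

lemma P_bound_scale_less:
  assumes "0 < c" "P_bound M \<alpha> X x < q"
  shows "P_bound M \<alpha> (\<lambda>\<omega>. c * X \<omega>) (c * x) < q"
proof -
  obtain t where t: "t > 0" "(\<integral>\<^sup>+ \<omega>. ennreal (h_fun \<alpha> (t * (X \<omega> - x))) \<partial>M) < q"
    using assms(2) by (auto simp: P_bound_less_iff)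
  \<comment> \<open>Passing from the parameter \<open>t\<close> to \<open>t / c\<close> undoes the
    scaling, so the expectation does not change.\<close>
  have "t / c * (c * X \<omega> - c * x) = t * (X \<omega> - x)" for \<omega>
    using assms(1) by (simp add: field_simps)
  then show ?thesis
    unfolding P_bound_less_iff using t assms(1) by (intro exI[of _ "t / c"]) simp
qed

lemma P_bound_add_less:
  assumes "1 \<le> \<alpha>"
    and [measurable]: "X \<in> borel_measurable M" "Y \<in> borel_measurable M"
    and "P_bound M \<alpha> X x < ennreal p" "P_bound M \<alpha> Y y < ennreal p"
  shows "P_bound M \<alpha> (\<lambda>\<omega>. X \<omega> + Y \<omega>) (x + y) < ennreal p"
proof -
  let ?E = "\<lambda>t X x. \<integral>\<^sup>+ \<omega>. ennreal (h_fun \<alpha> (t * (X \<omega> - x))) \<partial>M"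
  obtain t where t: "t > 0" "?E t X x < ennreal p"
    using assms by (auto simp: P_bound_less_iff)
  obtain s where s: "s > 0" "?E s Y y < ennreal p"
    using assms by (auto simp: P_bound_less_iff)
  \<comment> \<open>Expectations below \<open>ennreal p\<close> are finite, so the strict convex
    combination can be estimated in the reals.\<close>
  obtain a where a: "0 \<le> a" "?E t X x = ennreal a"
    using t(2) by (cases "?E t X x") auto
  obtain b where b: "0 \<le> b" "?E s Y y = ennreal b"
    using s(2) by (cases "?E s Y y") auto
  have ab: "a < p" "b < p"
    using t(2) s(2) a b by (simp_all add: ennreal_less_iff)
  \<comment> \<open>The weight \<open>u\<close> solves \<open>(1 - u) * t = u * s\<close>; the
    common value is the parameter \<open>r\<close> for the sum.\<close>
  define u where "u = t / (t + s)"
  define r where "r = t * s / (t + s)"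
  have u: "0 < u" "u < 1" and r: "0 < r"
    using t s by (auto simp: u_def r_def)
  have r_eq: "r = (1 - u) * t" "r = u * s"
    using t s by (auto simp: u_def r_def field_simps)
  have "?E r (\<lambda>\<omega>. X \<omega> + Y \<omega>) (x + y) \<le>
      (\<integral>\<^sup>+ \<omega>. ennreal (1 - u) * ennreal (h_fun \<alpha> (t * (X \<omega> - x)))
            + ennreal u * ennreal (h_fun \<alpha> (s * (Y \<omega> - y))) \<partial>M)"
  proof (rule nn_integral_mono)
    fix \<omega>
    have "r * (X \<omega> + Y \<omega> - (x + y)) = r * (X \<omega> - x) + r * (Y \<omega> - y)"
      by (simp add: algebra_simps)
    also have "\<dots> = (1 - u) * (t * (X \<omega> - x)) + u * (s * (Y \<omega> - y))"
      by (metis r_eq mult.assoc)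
    finally have "h_fun \<alpha> (r * (X \<omega> + Y \<omega> - (x + y))) \<le>
        (1 - u) * h_fun \<alpha> (t * (X \<omega> - x)) + u * h_fun \<alpha> (s * (Y \<omega> - y))"
      using convex_onD[OF convex_on_h_fun[OF assms(1)], of u] u by simp
    then show "ennreal (h_fun \<alpha> (r * (X \<omega> + Y \<omega> - (x + y)))) \<le>
        ennreal (1 - u) * ennreal (h_fun \<alpha> (t * (X \<omega> - x)))
          + ennreal u * ennreal (h_fun \<alpha> (s * (Y \<omega> - y)))"
      using u by (simp add: h_fun_nonneg ennreal_leI flip: ennreal_mult ennreal_plus)
  qed
  also have "\<dots> = ennreal (1 - u) * ?E t X x + ennreal u * ?E s Y y"
    by (simp add: nn_integral_add nn_integral_cmult)
  also have "\<dots> = ennreal ((1 - u) * a + u * b)"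
    using u a b by (simp flip: ennreal_mult ennreal_plus)
  also have "\<dots> < ennreal p"
  proof (rule ennreal_lessI)
    show "(1 - u) * a + u * b < p"
      using u ab by (intro convex_bound_lt) auto
  qed (use a(1) ab(1) in linarith)
  finally show ?thesis
    unfolding P_bound_less_iff using r by blast
qed

section \<open>From admissible thresholds to the quantile bound\<close>

lemma Q_bound_le: "P_bound M \<alpha> X x < ennreal p \<Longrightarrow> Q_bound M \<alpha> X p \<le> ereal x"
  unfolding Q_bound_def by (rule INF_lower) simp

text \<open>Increasing affine maps commute with infima. This carries a lower bound valid at all
  admissible points over to their infimum, also when \<open>z\<close> or the infimum is
  infinite.\<close>

lemma le_affine_Q_bound:
  assumes "0 < a" "\<And>x. P_bound M \<alpha> X x < ennreal p \<Longrightarrow> z \<le> ereal (a * x + b)"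
  shows "z \<le> ereal a * Q_bound M \<alpha> X p + ereal b"
proof -
  have "(z - ereal b) / ereal a \<le> Q_bound M \<alpha> X p"
    unfolding Q_bound_def
  proof (rule INF_greatest)
    fix x assume "x \<in> {x. P_bound M \<alpha> X x < ennreal p}"
    with assms show "(z - ereal b) / ereal a \<le> ereal x"
      by (cases z) (fastforce simp: field_simps)+
  qed
  then show ?thesis
    using assms(1)
    by (cases z; cases "Q_bound M \<alpha> X p") (auto simp: field_simps)
qed

lemma Q_bound_mono:
  assumes "1 \<le> \<alpha>" "AE \<omega> in M. X \<omega> \<le> Y \<omega>"
  shows "Q_bound M \<alpha> X p \<le> Q_bound M \<alpha> Y p"
  unfolding Q_bound_def
proof (rule INF_superset_mono)
  have "P_bound M \<alpha> X x \<le> P_bound M \<alpha> Y x" for x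
    using assms by (intro P_bound_mono) auto
  then show "{x. P_bound M \<alpha> Y x < ennreal p} \<subseteq> {x. P_bound M \<alpha> X x < ennreal p}"
    by (auto intro: le_less_trans)
qed simp

lemma Q_bound_translate: "Q_bound M \<alpha> (\<lambda>\<omega>. X \<omega> + c) p = Q_bound M \<alpha> X p + ereal c"
proof -
  have le: "Q_bound M \<alpha> (\<lambda>\<omega>. X \<omega> + c) p \<le> Q_bound M \<alpha> X p + ereal c" for X :: "'a \<Rightarrow> real" and c
    using le_affine_Q_bound[of 1 M \<alpha> X p "Q_bound M \<alpha> (\<lambda>\<omega>. X \<omega> + c) p" c]
    by (simp add: Q_bound_le P_bound_translate one_ereal_def[symmetric])
  \<comment> \<open>The reverse inequality is the same bound for the shifted variable, shifted back
    by \<open>- c\<close>.\<close>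
  have "Q_bound M \<alpha> X p \<le> Q_bound M \<alpha> (\<lambda>\<omega>. X \<omega> + c) p + ereal (- c)"
    using le[of "\<lambda>\<omega>. X \<omega> + c" "- c"] by simp
  with le[of X c] show ?thesis
    by (cases "Q_bound M \<alpha> X p"; cases "Q_bound M \<alpha> (\<lambda>\<omega>. X \<omega> + c) p") auto
qed

lemma Q_bound_scale:
  assumes "0 < c"
  shows "Q_bound M \<alpha> (\<lambda>\<omega>. c * X \<omega>) p = ereal c * Q_bound M \<alpha> X p"
proof -
  have le: "Q_bound M \<alpha> (\<lambda>\<omega>. c * X \<omega>) p \<le> ereal c * Q_bound M \<alpha> X p"
    if "0 < c" for X :: "'a \<Rightarrow> real" and c
    using le_affine_Q_bound[OF that, of M \<alpha> X p "Q_bound M \<alpha> (\<lambda>\<omega>. c * X \<omega>) p" 0] that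
    by (simp add: Q_bound_le P_bound_scale_less)
  \<comment> \<open>Again the reverse inequality comes from the inverse operation, scaling by
    \<open>1 / c\<close>.\<close>
  have "Q_bound M \<alpha> X p \<le> ereal (1 / c) * Q_bound M \<alpha> (\<lambda>\<omega>. c * X \<omega>) p"
    using le[of "1 / c" "\<lambda>\<omega>. c * X \<omega>"] assms by simp
  with le[OF assms, of X] show ?thesis
    using assms
    by (cases "Q_bound M \<alpha> X p"; cases "Q_bound M \<alpha> (\<lambda>\<omega>. c * X \<omega>) p")
       (auto simp: field_simps)
qed

text \<open>The infimum is taken over \<open>x\<close> with \<open>y\<close> fixed, then over
  \<open>y\<close>. Since the bound for \<open>X\<close> is a real number \<open>q\<close>, it can
  serve as the affine offset in the second passage.\<close>

lemma Q_bound_add_le: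
  assumes "1 \<le> \<alpha>" "X \<in> borel_measurable M" "Y \<in> borel_measurable M"
    and "\<bar>Q_bound M \<alpha> X p\<bar> \<noteq> \<infinity>"
  shows "Q_bound M \<alpha> (\<lambda>\<omega>. X \<omega> + Y \<omega>) p \<le> Q_bound M \<alpha> X p + Q_bound M \<alpha> Y p"
proof -
  let ?Z = "Q_bound M \<alpha> (\<lambda>\<omega>. X \<omega> + Y \<omega>) p"
  obtain q where q: "Q_bound M \<alpha> X p = ereal q"
    using assms(4) by auto
  have "?Z \<le> ereal (1 * y + q)" if y: "P_bound M \<alpha> Y y < ennreal p" for y
  proof -
    have "?Z \<le> ereal (1 * x + y)" if "P_bound M \<alpha> X x < ennreal p" for x
      using Q_bound_le[OF P_bound_add_less[OF assms(1-3) that y]] by simp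
    then have "?Z \<le> ereal 1 * Q_bound M \<alpha> X p + ereal y"
      by (intro le_affine_Q_bound) auto
    then show ?thesis
      by (simp add: q add.commute)
  qed
  then have "?Z \<le> ereal 1 * Q_bound M \<alpha> Y p + ereal q"
    by (intro le_affine_Q_bound) auto
  then show ?thesis
    by (simp add: q add.commute one_ereal_def[symmetric])
qed

section \<open>Finiteness of the quantile bound\<close>

context prob_space
begin

text \<open>A Markov-type estimate: the indicator of the event \<open>x \<le> X \<omega>\<close>
  lies below \<open>h_fun \<alpha> (t * (X \<omega> - x))\<close>.\<close>

lemma prob_ge_less_of_P_bound_less:
  assumes "1 \<le> \<alpha>" and [measurable]: "X \<in> borel_measurable M"
    and "P_bound M \<alpha> X x < ennreal p"
  shows "prob {\<omega> \<in> space M. x \<le> X \<omega>} < p"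
proof -
  obtain t where t: "t > 0" "(\<integral>\<^sup>+ \<omega>. ennreal (h_fun \<alpha> (t * (X \<omega> - x))) \<partial>M) < ennreal p"
    using assms by (auto simp: P_bound_less_iff)
  have "emeasure M {\<omega> \<in> space M. x \<le> X \<omega>} =
      (\<integral>\<^sup>+ \<omega>. indicator {\<omega> \<in> space M. x \<le> X \<omega>} \<omega> \<partial>M)"
    by simp
  also have "\<dots> \<le> (\<integral>\<^sup>+ \<omega>. ennreal (h_fun \<alpha> (t * (X \<omega> - x))) \<partial>M)"
    using t(1) assms(1)
    by (intro nn_integral_mono) (auto simp: indicator_def intro!: h_fun_ge_one)
  also have "\<dots> < ennreal p"
    by (rule t(2))
  finally show ?thesis
    by (simp add: emeasure_eq_measure ennreal_less_iff)
qed

text \<open>Continuity from below: the events that X is at least -n increase to the whole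
  space.\<close>

lemma exists_prob_ge_greater:
  fixes X :: "'a \<Rightarrow> real"
  assumes [measurable]: "X \<in> borel_measurable M" and "p < 1"
  obtains x where "p < prob {\<omega> \<in> space M. x \<le> X \<omega>}"
proof -
  let ?A = "\<lambda>n::nat. {\<omega> \<in> space M. - real n \<le> X \<omega>}"
  have "(\<Union>n. ?A n) = space M"
  proof -
    have "\<exists>n. - real n \<le> X \<omega>" for \<omega>
      using real_arch_simple[of "- X \<omega>"] by (auto simp: minus_le_iff)
    then show ?thesis
      by auto
  qed
  moreover have "(\<lambda>n. prob (?A n)) \<longlonglongrightarrow> prob (\<Union>n. ?A n)"
    by (rule finite_Lim_measure_incseq) (auto simp: incseq_def)
  ultimately have "(\<lambda>n. prob (?A n)) \<longlonglongrightarrow> 1"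
    by (simp add: prob_space)
  then have "eventually (\<lambda>n. p < prob (?A n)) sequentially"
    using \<open>p < 1\<close> by (rule order_tendstoD)
  then show ?thesis
    using that by (auto dest: eventually_happens)
qed

lemma Q_bound_not_MInfty:
  assumes "1 \<le> \<alpha>" "X \<in> borel_measurable M" "p < 1"
  shows "Q_bound M \<alpha> X p \<noteq> -\<infinity>"
proof -
  have [measurable]: "X \<in> borel_measurable M"
    by fact
  obtain x0 where x0: "p < prob {\<omega> \<in> space M. x0 \<le> X \<omega>}"
    using exists_prob_ge_greater assms by blast
  have "ereal x0 \<le> Q_bound M \<alpha> X p"
    unfolding Q_bound_def
  proof (rule INF_greatest)
    fix x assume "x \<in> {x. P_bound M \<alpha> X x < ennreal p}"
    then have less: "prob {\<omega> \<in> space M. x \<le> X \<omega>} < p"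
      using assms by (intro prob_ge_less_of_P_bound_less) auto
    \<comment> \<open>Tail probabilities decrease in the threshold, so an admissible
      \<open>x\<close> at or below \<open>x0\<close> would have a tail probability above
      \<open>p\<close>.\<close>
    have "prob {\<omega> \<in> space M. x0 \<le> X \<omega>} \<le> prob {\<omega> \<in> space M. x \<le> X \<omega>}" if "x \<le> x0"
      using that by (intro finite_measure_mono) auto
    with less x0 show "ereal x0 \<le> ereal x"
      by force
  qed
  then show ?thesis
    by auto
qed

text \<open>Integrability enters here. With moment \<open>k\<close>, the threshold and the parameter
  are chosen so that the expectation equals \<open>p / (k + 1) * k\<close>; the added 1 makes this
  strictly less than \<open>p\<close>.\<close>

lemma exists_P_bound_less:
  assumes "1 \<le> \<alpha>" "X \<in> X_class M \<alpha>" "0 < p"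
  obtains x where "P_bound M \<alpha> X x < ennreal p"
  using assms(1)
proof (cases rule: ge_one_ereal_cases)
  case 1
  then obtain t where [measurable]: "X \<in> borel_measurable M"
    and t: "t > 0" "(\<integral>\<^sup>+ \<omega>. ennreal (exp (t * X \<omega>)) \<partial>M) < \<infinity>"
    using assms(2) by (auto simp: X_class_def)
  then obtain k where k: "0 \<le> k" "(\<integral>\<^sup>+ \<omega>. ennreal (exp (t * X \<omega>)) \<partial>M) = ennreal k"
    by (cases "\<integral>\<^sup>+ \<omega>. ennreal (exp (t * X \<omega>)) \<partial>M") auto
  \<comment> \<open>Chosen so that \<open>exp (- t * x)\<close> equals
    \<open>p / (k + 1)\<close>.\<close>
  define x where "x = ln ((k + 1) / p) / t"
  have "(\<integral>\<^sup>+ \<omega>. ennreal (h_fun \<alpha> (t * (X \<omega> - x))) \<partial>M) =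
      (\<integral>\<^sup>+ \<omega>. ennreal (p / (k + 1)) * ennreal (exp (t * X \<omega>)) \<partial>M)"
    using 1 t(1) k(1) assms(3)
    by (intro nn_integral_cong) (simp add: x_def right_diff_distrib exp_diff flip: ennreal_mult)
  also have "\<dots> = ennreal (p / (k + 1)) * ennreal k"
    by (simp add: nn_integral_cmult k(2))
  also have "\<dots> = ennreal (p / (k + 1) * k)"
    using k(1) assms(3) by (intro ennreal_mult[symmetric]) auto
  also have "\<dots> < ennreal p"
    using k assms(3) by (simp add: ennreal_less_iff field_simps)
  finally have "P_bound M \<alpha> X x < ennreal p"
    unfolding P_bound_less_iff using t(1) by blast
  then show ?thesis
    by (rule that)
next
  case (2 a)
  let ?I = "\<integral>\<^sup>+ \<omega>. ennreal (max 0 (X \<omega>) powr a) \<partial>M"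
  have [measurable]: "X \<in> borel_measurable M" and fin: "?I < \<infinity>"
    using assms(2) 2 by (auto simp: X_class_def)
  then obtain k where k: "0 \<le> k" "?I = ennreal k"
    by (cases ?I) auto
  define x where "x = ((k + 1) / p) powr (1 / a)"
  have x: "0 < x" "x powr a = (k + 1) / p"
    using k(1) 2 assms(3) by (auto simp: x_def powr_powr)
  \<comment> \<open>The parameter \<open>a / x\<close> cancels the constant 1 in
    \<open>h_fun\<close>: what remains is the power of \<open>max 0 (X \<omega>) / x\<close>, a
    multiple of the given moment's integrand.\<close>
  have *: "max 0 (1 + a / x * (X \<omega> - x) / a) powr a = p / (k + 1) * max 0 (X \<omega>) powr a" for \<omega>
  proof -
    have "1 + a / x * (X \<omega> - x) / a = X \<omega> / x"
      using x(1) 2 by (simp add: field_simps)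
    moreover have "max 0 (X \<omega> / x) = max 0 (X \<omega>) / x"
      using x(1) by (auto simp: max_def field_simps)
    ultimately show ?thesis
      using x by (simp add: powr_divide)
  qed
  have "(\<integral>\<^sup>+ \<omega>. ennreal (h_fun \<alpha> (a / x * (X \<omega> - x))) \<partial>M) =
      (\<integral>\<^sup>+ \<omega>. ennreal (p / (k + 1)) * ennreal (max 0 (X \<omega>) powr a) \<partial>M)"
    using 2 k(1) assms(3)
    by (intro nn_integral_cong) (simp only: h_fun_ereal *, simp flip: ennreal_mult)
  also have "\<dots> = ennreal (p / (k + 1)) * ennreal k"
    by (simp add: nn_integral_cmult k(2))
  also have "\<dots> = ennreal (p / (k + 1) * k)"
    using k(1) assms(3) by (intro ennreal_mult[symmetric]) auto
  also have "\<dots> < ennreal p"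
    using k assms(3) by (simp add: ennreal_less_iff field_simps)
  finally have "P_bound M \<alpha> X x < ennreal p"
    unfolding P_bound_less_iff using x(1) 2(2) by (intro exI[of _ "a / x"]) simp
  then show ?thesis
    by (rule that)
qed

lemma Q_bound_finite:
  assumes "1 \<le> \<alpha>" "X \<in> X_class M \<alpha>" "0 < p" "p < 1"
  shows "\<bar>Q_bound M \<alpha> X p\<bar> \<noteq> \<infinity>"
proof -
  have "X \<in> borel_measurable M"
    using assms(2) by (auto simp: X_class_def split: if_splits)
  then have "Q_bound M \<alpha> X p \<noteq> -\<infinity>"
    using assms by (intro Q_bound_not_MInfty)
  moreover obtain x where "P_bound M \<alpha> X x < ennreal p"
    using exists_P_bound_less assms by blast
  then have "Q_bound M \<alpha> X p \<le> ereal x"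
    by (rule Q_bound_le)
  ultimately show ?thesis
    by auto
qed

lemma zero_in_X_class: "(\<lambda>\<omega>. 0) \<in> X_class M \<alpha>"
  by (auto simp: X_class_def emeasure_space_1 intro!: exI[of _ 1])

lemma Q_bound_zero:
  assumes "1 \<le> \<alpha>" "0 < p" "p < 1"
  shows "Q_bound M \<alpha> (\<lambda>\<omega>. 0) p = 0"
proof -
  text \<open>A finite value that is invariant under multiplication by 2 vanishes.\<close>
  have "Q_bound M \<alpha> (\<lambda>\<omega>. 0) p = ereal 2 * Q_bound M \<alpha> (\<lambda>\<omega>. 0) p"
    using Q_bound_scale[of 2 M \<alpha> "\<lambda>\<omega>. 0" p] by simp
  then show ?thesis
    using Q_bound_finite[OF assms(1) zero_in_X_class assms(2,3)]
    by (cases "Q_bound M \<alpha> (\<lambda>\<omega>. 0) p") auto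
qed

end

theorem corollary4p1:
  fixes M :: "'a measure" and \<alpha> :: ereal and p :: real
  assumes "prob_space M"
    and "1 \<le> \<alpha>"
    and "0 < p" and "p < 1"
  shows "coherent_risk_measure_on M (X_class M \<alpha>) (\<lambda>X. Q_bound M \<alpha> X p)"
proof -
  interpret prob_space M
    by fact
  have meas: "X \<in> borel_measurable M" if "X \<in> X_class M \<alpha>" for X
    using that by (auto simp: X_class_def split: if_splits)
  have scale: "Q_bound M \<alpha> (\<lambda>\<omega>. c * X \<omega>) p = ereal c * Q_bound M \<alpha> X p" if "0 \<le> c" for X c
  proof (cases "c = 0")
    \<comment> \<open>The product of 0 with any extended real is 0, so only the bound of the
      constant 0 has to be evaluated.\<close>
    case True
    then show ?thesis
      using Q_bound_zero[OF assms(2-4)] by (simp add: zero_ereal_def[symmetric])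
  next
    case False
    with that show ?thesis
      by (intro Q_bound_scale) simp
  qed
  have finite: "\<bar>Q_bound M \<alpha> X p\<bar> \<noteq> \<infinity>" if "X \<in> X_class M \<alpha>" for X
    using assms(2) that assms(3,4) by (rule Q_bound_finite)
  show ?thesis
    unfolding coherent_risk_measure_on_def
  proof (intro conjI ballI allI impI)
    fix X Y
    assume "X \<in> X_class M \<alpha>" "Y \<in> X_class M \<alpha>"
    then show "Q_bound M \<alpha> (\<lambda>\<omega>. X \<omega> + Y \<omega>) p \<le> Q_bound M \<alpha> X p + Q_bound M \<alpha> Y p"
      by (intro Q_bound_add_le[OF assms(2)] meas finite)
  next
    fix X Y :: "'a \<Rightarrow> real"
    assume "AE \<omega> in M. X \<omega> \<le> Y \<omega>"
    then show "Q_bound M \<alpha> X p \<le> Q_bound M \<alpha> Y p"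
      by (rule Q_bound_mono[OF assms(2)])
  qed (erule finite | rule Q_bound_translate | erule scale)+
qed

end
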